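(* Let $\mathcal I=(t,m,n,\mathcal X,\mathcal X^{(S)},R)$ be an instance of the ICCSI problem over $\mathbb F_q$ with message space $\mathcal M\subset\mathbb F_q^{n\times t}$, let $\delta\ge0$ be an integer and let $N$ be a positive integer. Let $w$ denote either the Hamming weight or (when $t>1$) the rank weight. A matrix $L\in\mathbb F_q^{N\times d_S}$ represents an $\mathbb F_q$-linear $(\mathcal I,\delta)$-ECIC (with respect to $w$) if and only if for all $i\in[m]$ it holds that $$w\bigl(LV^{(S)}(X-X')\bigr)\ge2\delta+1$$ for all $X,X'\in\mathcal M$ such that $X-X'\in\mathcal Z^{(i)}$.
   Context: Notation: $q$ is a prime power, $\mathbb F_q$ the field with $q$ elements, $[m]=\{1,\dots,m\}$. For a matrix $A$, $A_i$ is its $i$-th row and $\langle A\rangle$ its row space. The Hamming weight of a matrix is its number of nonzero rows; the rank weight is its rank over $\mathbb F_q$. Instance: an instance $\mathcal I=(t,m,n,\mathcal X,\mathcal X^{(S)},R)$ of the Index Coding with Coded Side Information (ICCSI) problem consists of positive integers $t,m,n$; subspaces $\mathcal X^{(S)}$ and $\mathcal X^{(i)}$ ($i\in[m]$) of $\mathbb F_q^n$ of dimensions $d_S$ and $d_i$; $\mathcal X=\{A\in\mathbb F_q^{m\times n}:A_i\in\mathcal X^{(i)},\ i\in[m]\}$; and a matrix $R\in\mathbb F_q^{m\times n}$ with rows $R_i\in\mathcal X^{(S)}\setminus\mathcal X^{(i)}$. Fix matrices $V^{(S)}\in\mathbb F_q^{d_S\times n}$ and $V^{(i)}\in\mathbb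 F_q^{d_i\times n}$ with $\langle V^{(S)}\rangle=\mathcal X^{(S)}$, $\langle V^{(i)}\rangle=\mathcal X^{(i)}$. Set $\mathcal Z^{(i)}=\{Z\in\mathbb F_q^{n\times t}:V^{(i)}Z=0,\ R_iZ\ne0\}$. Error-correcting index codes: a map $E:\mathbb F_q^{n\times t}\to\mathbb F_q^{N\times t}$ is an $(\mathcal I,\delta)$-ECIC of length $N$ if for each $i\in[m]$ there is a decoding map $D_i:\mathbb F_q^{N\times t}\times\mathbb F_q^{d_i\times t}\to\mathbb F_q^t$ with $D_i(E(X)+W,V^{(i)}X)=R_iX$ for all $X\in\mathcal M$ and all $W\in\mathbb F_q^{N\times t}$ with $w(W)\le\delta$. It is $\mathbb F_q$-linear if $E(X)=LV^{(S)}X$ for some $L\in\mathbb F_q^{N\times d_S}$; then $L$ is said to represent it. *)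

theory Defs
  imports "Jordan_Normal_Form.DL_Rank"
begin

text \<open>
  The field with \<open>q\<close> elements is a type \<open>'a\<close> of classes \<open>finite\<close> and \<open>field\<close>.
  The index set \<open>[m]\<close> is represented as \<open>{0..<m}\<close>, matching the 0-based matrix rows.
\<close>

text \<open>
  The dimension of a subspace \<open>U\<close> of the space of vectors of length \<open>n\<close>;
  the update of the carrier is how the library restricts a vector space to a subspace.
\<close>

definition subspace_dim :: "nat \<Rightarrow> 'a::field vec set \<Rightarrow> nat" where
  "subspace_dim n U = vectorspace.dim class_ring ((module_vec TYPE('a) n)\<lparr>carrier := U\<rparr>)"

record 'a iccsi =
  blk :: nat                          \<comment> \<open>\<open>t\<close>\<close>
  users :: nat                        \<comment> \<open>\<open>m\<close>\<close>
  len :: nat                          \<comment> \<open>\<open>n\<close>\<close>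
  user_space :: "nat \<Rightarrow> 'a vec set"    \<comment> \<open>\<open>X\<close> with superscript \<open>(i)\<close>\<close>
  side_info :: "'a mat set"           \<comment> \<open>calligraphic \<open>X\<close>\<close>
  sender_space :: "'a vec set"        \<comment> \<open>\<open>X\<close> with superscript \<open>(S)\<close>\<close>
  request :: "'a mat"                 \<comment> \<open>\<open>R\<close>\<close>

definition iccsi_instance :: "'a::{finite,field} iccsi \<Rightarrow> bool" where
  "iccsi_instance I \<longleftrightarrow>
     0 < blk I \<and> 0 < users I \<and> 0 < len I \<and>
     VectorSpace.subspace class_ring (sender_space I) (module_vec TYPE('a) (len I)) \<and>
     (\<forall>i<users I. VectorSpace.subspace class_ring (user_space I i) (module_vec TYPE('a) (len I))) \<and>
     side_info I = {A \<in> carrier_mat (users I) (len I). \<forall>i<users I. row A i \<in> user_space I i} \<and>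
     request I \<in> carrier_mat (users I) (len I) \<and>
     (\<forall>i<users I. row (request I) i \<in> sender_space I - user_space I i)"

abbreviation sender_dim :: "'a::field iccsi \<Rightarrow> nat" where
  "sender_dim I \<equiv> subspace_dim (len I) (sender_space I)"

abbreviation user_dim :: "'a::field iccsi \<Rightarrow> nat \<Rightarrow> nat" where
  "user_dim I i \<equiv> subspace_dim (len I) (user_space I i)"

definition generator_matrices :: "'a::field iccsi \<Rightarrow> 'a mat \<Rightarrow> (nat \<Rightarrow> 'a mat) \<Rightarrow> bool" where
  "generator_matrices I VS V \<longleftrightarrow>
     VS \<in> carrier_mat (sender_dim I) (len I) \<and>
     vec_space.row_space (len I) VS = sender_space I \<and>
     (\<forall>i<users I. V i \<in> carrier_mat (user_dim I i) (len I) \<and>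
                  vec_space.row_space (len I) (V i) = user_space I i)"

text \<open>The product of a row vector with a matrix.\<close>

definition row_mult :: "'a::comm_semiring_0 vec \<Rightarrow> 'a mat \<Rightarrow> 'a vec" where
  "row_mult v A = A\<^sup>T *\<^sub>v v"

definition confusion_set :: "'a::field iccsi \<Rightarrow> (nat \<Rightarrow> 'a mat) \<Rightarrow> nat \<Rightarrow> 'a mat set" where
  "confusion_set I V i =
     {Z \<in> carrier_mat (len I) (blk I).
        V i * Z = 0\<^sub>m (user_dim I i) (blk I) \<and> row_mult (row (request I) i) Z \<noteq> 0\<^sub>v (blk I)}"

definition hamming_weight :: "'a::zero mat \<Rightarrow> nat" where
  "hamming_weight A = card {i. i < dim_row A \<and> row A i \<noteq> 0\<^sub>v (dim_col A)}"

definition rank_weight :: "'a::field mat \<Rightarrow> nat" where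
  "rank_weight A = vec_space.rank (dim_row A) A"

definition is_ECIC ::
  "('a::field mat \<Rightarrow> nat) \<Rightarrow> 'a iccsi \<Rightarrow> (nat \<Rightarrow> 'a mat) \<Rightarrow> 'a mat set \<Rightarrow> nat \<Rightarrow> nat
     \<Rightarrow> ('a mat \<Rightarrow> 'a mat) \<Rightarrow> bool" where
  "is_ECIC w I V M \<delta> N E \<longleftrightarrow>
     E \<in> carrier_mat (len I) (blk I) \<rightarrow> carrier_mat N (blk I) \<and>
     (\<forall>i<users I. \<exists>D.
        D \<in> carrier_mat N (blk I) \<rightarrow> carrier_mat (user_dim I i) (blk I) \<rightarrow> carrier_vec (blk I) \<and>
        (\<forall>X\<in>M. \<forall>W\<in>carrier_mat N (blk I). w W \<le> \<delta> \<longrightarrow>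
           D (E X + W) (V i * X) = row_mult (row (request I) i) X))"

definition represents_linear_ECIC ::
  "('a::field mat \<Rightarrow> nat) \<Rightarrow> 'a iccsi \<Rightarrow> 'a mat \<Rightarrow> (nat \<Rightarrow> 'a mat) \<Rightarrow> 'a mat set \<Rightarrow> nat \<Rightarrow> nat
     \<Rightarrow> 'a mat \<Rightarrow> bool" where
  "represents_linear_ECIC w I VS V M \<delta> N L \<longleftrightarrow>
     L \<in> carrier_mat N (sender_dim I) \<and>
     (\<exists>E. is_ECIC w I V M \<delta> N E \<and>
          (\<forall>X\<in>carrier_mat (len I) (blk I). E X = L * VS * X))"

end

theory Submission
  imports Defs
begin

text \<open>
  Decoding fails exactly when two messages that receiver \<open>i\<close> has to distinguish, but cannot
  distinguish by its side information, are mapped to words whose balls of radius \<open>\<delta>\<close> meet.  So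
  all that matters about the weight is that the matrices of weight at most \<open>2\<delta>\<close> are exactly the
  differences of two matrices of weight at most \<open>\<delta>\<close>.  For the Hamming weight one distributes
  the nonzero rows; for the rank weight one expresses the columns in a basis of the column space
  and distributes the basis vectors.
\<close>

subsection \<open>The Hamming weight\<close>

lemma hamming_weight_diff_le:
  fixes B C :: "'a::ring mat"
  assumes "B \<in> carrier_mat N t" and "C \<in> carrier_mat N t"
  shows "hamming_weight (B - C) \<le> hamming_weight B + hamming_weight C"
proof -
  let ?nz = "\<lambda>A. {i. i < dim_row A \<and> row A i \<noteq> 0\<^sub>v (dim_col A)}"
  have "?nz (B - C) \<subseteq> ?nz B \<union> ?nz C"
    using assms by (auto simp: vec_eq_iff)
  then have "card (?nz (B - C)) \<le> card (?nz B \<union> ?nz C)"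
    by (intro card_mono) auto
  also have "\<dots> \<le> card (?nz B) + card (?nz C)"
    by (rule card_Un_le)
  finally show ?thesis
    by (simp add: hamming_weight_def)
qed

lemma hamming_weight_le_card:
  assumes "finite S" and "\<And>i j. \<lbrakk>i < dim_row A; j < dim_col A; i \<notin> S\<rbrakk> \<Longrightarrow> A $$ (i, j) = 0"
  shows "hamming_weight A \<le> card S"
proof -
  have "i \<in> S" if "i < dim_row A" "row A i \<noteq> 0\<^sub>v (dim_col A)" for i
  proof (rule ccontr)
    assume "i \<notin> S"
    then have "row A i = 0\<^sub>v (dim_col A)"
      using assms(2) that(1) by (intro eq_vecI) auto
    with that(2) show False by simp
  qed
  then show ?thesis
    unfolding hamming_weight_def using assms(1) by (intro card_mono) auto
qed

text \<open>Taking \<open>min \<delta> (card S)\<close> elements for \<open>T\<close> leaves at most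
  \<delta> behind. Both weights are halved this way: \<open>S\<close> is the set of nonzero row
  indices for the Hamming weight and a basis of the column space for the rank weight.\<close>

lemma obtain_subset_halving_card:
  fixes \<delta> :: nat
  assumes "finite S" and "card S \<le> 2 * \<delta>"
  obtains T where "T \<subseteq> S" and "card T \<le> \<delta>" and "card (S - T) \<le> \<delta>"
proof -
  obtain T where T: "T \<subseteq> S" "card T = min \<delta> (card S)"
    using obtain_subset_with_card_n[of "min \<delta> (card S)" S] by auto
  moreover from T assms have "card (S - T) = card S - card T"
    by (meson card_Diff_subset finite_subset)
  ultimately show thesis
    using that[of T] assms(2) by auto
qed

text \<open>Forwards, half of the nonzero rows go to \<open>B\<close> and the other half, negated,
  to \<open>C\<close>. Backwards, this is subadditivity of the weight.\<close>

lemma hamming_weight_le_double_iff: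
  fixes A :: "'a::ring mat"
  assumes A: "A \<in> carrier_mat N t"
  shows "hamming_weight A \<le> 2 * \<delta> \<longleftrightarrow>
    (\<exists>B\<in>carrier_mat N t. \<exists>C\<in>carrier_mat N t.
       A = B - C \<and> hamming_weight B \<le> \<delta> \<and> hamming_weight C \<le> \<delta>)"
proof
  let ?S = "{i. i < dim_row A \<and> row A i \<noteq> 0\<^sub>v (dim_col A)}"
  assume "hamming_weight A \<le> 2 * \<delta>"
  then have le: "card ?S \<le> 2 * \<delta>"
    by (simp add: hamming_weight_def)
  obtain T where T: "T \<subseteq> ?S" and card_T: "card T \<le> \<delta>" "card (?S - T) \<le> \<delta>"
    by (rule obtain_subset_halving_card[OF _ le]) simp_all
  have fin: "finite T"
    using T by (rule finite_subset) simp
  define B where "B = mat N t (\<lambda>(i, j). if i \<in> T then A $$ (i, j) else 0)"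
  define C where "C = mat N t (\<lambda>(i, j). if i \<in> T then 0 else - A $$ (i, j))"
  have "hamming_weight B \<le> \<delta>"
    using fin card_T(1) by (intro order_trans[OF hamming_weight_le_card[of T]]) (auto simp: B_def)
  \<comment> \<open>\<open>C\<close> is supported on \<open>?S - T\<close>: rows in \<open>T\<close>
    were set to zero, and rows outside \<open>?S\<close> already vanish in \<open>A\<close>.\<close>
  moreover have "hamming_weight C \<le> \<delta>"
    using A card_T(2)
    by (intro order_trans[OF hamming_weight_le_card[of "?S - T"]]) (auto simp: C_def vec_eq_iff)
  moreover have "A = B - C"
    using A by (auto simp: B_def C_def)
  moreover have "B \<in> carrier_mat N t" "C \<in> carrier_mat N t"
    by (simp_all add: B_def C_def)
  ultimately show "\<exists>B\<in>carrier_mat N t. \<exists>C\<in>carrier_mat N t.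
       A = B - C \<and> hamming_weight B \<le> \<delta> \<and> hamming_weight C \<le> \<delta>"
    by blast
next
  assume "\<exists>B\<in>carrier_mat N t. \<exists>C\<in>carrier_mat N t.
       A = B - C \<and> hamming_weight B \<le> \<delta> \<and> hamming_weight C \<le> \<delta>"
  then obtain B C where BC: "B \<in> carrier_mat N t" "C \<in> carrier_mat N t"
    "A = B - C" "hamming_weight B \<le> \<delta>" "hamming_weight C \<le> \<delta>"
    by blast
  then show "hamming_weight A \<le> 2 * \<delta>"
    using hamming_weight_diff_le[OF BC(1,2)] by simp
qed

subsection \<open>The rank weight\<close>

context vec_space
begin

lemma obtain_maximal_lin_indpt_subset:
  assumes "finite S"
  obtains U where "maximal U (\<lambda>T. T \<subseteq> S \<and> lin_indpt T)" and "finite U"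
proof -
  have "lin_indpt {}"
    by (auto simp: lin_dep_def)
  then show thesis
    using maximal_exists_superset[of S "\<lambda>T. T \<subseteq> S \<and> lin_indpt T" "{}"] assms that by auto
qed

text \<open>The column space is a subspace of \<open>span S\<close>. As \<open>S\<close> may be
  dependent, the dimension of its span is read off a maximal independent subset \<open>U\<close>,
  which has at most \<open>card S\<close> elements.\<close>

lemma rank_le_card_if_cols_in_span:
  assumes A: "A \<in> carrier_mat n nc"
    and S: "finite S" "S \<subseteq> carrier_vec n" "set (cols A) \<subseteq> span S"
  shows "rank A \<le> card S"
proof -
  obtain U where U: "maximal U (\<lambda>T. T \<subseteq> S \<and> lin_indpt T)" "finite U"
    using obtain_maximal_lin_indpt_subset[OF S(1)] .
  have dim_S: "vectorspace.dim class_ring (span_vs S) = card U"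
    using dim_span S U by simp
  have sub: "subspace class_ring (span S) V" "subspace class_ring (span (set (cols A))) V"
    using S A cols_dim[of A] by (auto intro!: span_is_subspace)
  have incl: "span (set (cols A)) \<subseteq> span S"
    using S span_subsetI by simp
  have "rank A \<le> vectorspace.dim class_ring (span_vs S)"
    unfolding rank_def
    using vectorspace.subspace_dim[OF subspace_is_vs[OF sub(1)] nested_subspaces[OF sub incl]
        fin_dim_span[OF S(1)]] S(2) fin_dim_span_cols[OF A] by simp
  also have "\<dots> \<le> card S"
    using dim_S U S(1) by (simp add: card_mono maximal_def)
  finally show ?thesis .
qed

text \<open>A maximal independent set of columns works: a column outside its span could be adjoined
  without losing independence, and its cardinality is the rank.\<close>

lemma obtain_column_basis:
  assumes A: "A \<in> carrier_mat n nc"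
  obtains S where "finite S" "S \<subseteq> carrier_vec n" "card S = rank A" "set (cols A) \<subseteq> span S"
proof -
  have carr: "set (cols A) \<subseteq> carrier_vec n"
    using A cols_dim[of A] by auto
  obtain S where S: "maximal S (\<lambda>T. T \<subseteq> set (cols A) \<and> lin_indpt T)" "finite S"
    using obtain_maximal_lin_indpt_subset[of "set (cols A)"] by blast
  then have sub: "S \<subseteq> set (cols A)" and indpt: "lin_indpt S"
    by (auto simp: maximal_def)
  have "c \<in> span S" if "c \<in> set (cols A)" for c
  proof (rule ccontr)
    assume nin: "c \<notin> span S"
    have S_carr: "S \<subseteq> carrier_vec n" and c_carr: "c \<in> carrier_vec n"
      using sub carr that by auto
    then have c_nin: "c \<notin> S"
      using nin span_mem[OF S_carr, of c] by argo
    then have "lin_indpt (S \<union> {c})"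
      using lin_dep_iff_in_span[of S c] S_carr c_carr indpt nin by simp
    moreover have "S \<union> {c} \<subseteq> set (cols A)" "S \<subseteq> S \<union> {c}"
      using sub that by auto
    ultimately have "S \<union> {c} = S"
      using S(1) unfolding maximal_def by metis
    with c_nin show False by blast
  qed
  then show thesis
    using that[of S] S rank_card_indpt[OF A S(1)] sub carr by auto
qed

text \<open>Rank is subadditive on sums, so it remains to bound the rank of \<open>- C\<close>; its
  columns lie in the span of a column basis of \<open>C\<close>.\<close>

lemma rank_diff_le:
  assumes B: "B \<in> carrier_mat n nc" and C: "C \<in> carrier_mat n nc"
  shows "rank (B - C) \<le> rank B + rank C"
proof -
  obtain S where S: "finite S" "S \<subseteq> carrier_vec n" "card S = rank C" "set (cols C) \<subseteq> span S"
    using obtain_column_basis[OF C] .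
  have "set (cols (- C)) \<subseteq> span S"
  proof
    fix c assume "c \<in> set (cols (- C))"
    then obtain j where j: "j < nc" "c = col (- C) j"
      using C by (auto simp: cols_def)
    then have "c = - 1 \<cdot>\<^sub>v col C j" "col C j \<in> span S"
      using C S(4) by (auto simp: cols_def)
    then show "c \<in> span S"
      using S(2) smult_in_span by simp
  qed
  then have "rank (- C) \<le> rank C"
    using rank_le_card_if_cols_in_span[of "- C" nc S] C S by simp
  moreover have "B - C = B + - C"
    using B C by (intro eq_matI) auto
  ultimately show ?thesis
    using rank_subadditive[OF B, of "- C"] C by simp
qed

text \<open>The rank analogue of row splitting: the columns are expanded in a basis of the column
  space, and each half of the basis contributes a summand of rank at most its size.\<close>

lemma rank_le_double_iff:
  assumes A: "A \<in> carrier_mat n nc"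
  shows "rank A \<le> 2 * \<delta> \<longleftrightarrow>
    (\<exists>B\<in>carrier_mat n nc. \<exists>C\<in>carrier_mat n nc. A = B - C \<and> rank B \<le> \<delta> \<and> rank C \<le> \<delta>)"
proof
  assume le: "rank A \<le> 2 * \<delta>"
  obtain S where S: "finite S" "S \<subseteq> carrier_vec n" "card S = rank A" "set (cols A) \<subseteq> span S"
    using obtain_column_basis[OF A] .
  obtain T where T: "T \<subseteq> S" "card T \<le> \<delta>" "card (S - T) \<le> \<delta>"
    using obtain_subset_halving_card[of S \<delta>] S le by auto
  have "\<exists>a. col A j = lincomb a S" if "j < nc" for j
  proof -
    have "col A j \<in> span S"
      using S(4) that A by (auto simp: cols_def)
    then show ?thesis
      using S finite_span by auto
  qed
  then obtain a where a: "\<And>j. j < nc \<Longrightarrow> col A j = lincomb (a j) S"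
    by metis
  \<comment> \<open>Each column of \<open>part U\<close> is the expansion of the same column of
    \<open>A\<close>, truncated to the basis vectors in \<open>U\<close>.\<close>
  define part where "part U = mat n nc (\<lambda>(i, j). \<Sum>x\<in>U. a j x * x $ i)" for U
  have part_carrier: "part U \<in> carrier_mat n nc" for U
    by (simp add: part_def)
  have rank_part: "rank (part U) \<le> card U" if "U \<subseteq> S" for U
  proof (rule rank_le_card_if_cols_in_span)
    have U: "finite U" "U \<subseteq> carrier_vec n"
      using that S finite_subset by auto
    then show "finite U" "U \<subseteq> carrier_vec n" .
    have "col (part U) j = lincomb (a j) U" if "j < nc" for j
    proof (rule eq_vecI)
      show "dim_vec (col (part U) j) = dim_vec (lincomb (a j) U)"
        unfolding lincomb_dim[OF U] by (simp add: part_def)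
      fix i assume "i < dim_vec (lincomb (a j) U)"
      then have "i < n"
        unfolding lincomb_dim[OF U] .
      with \<open>j < nc\<close> show "col (part U) j $ i = lincomb (a j) U $ i"
        by (simp add: lincomb_index[OF _ U(2)] part_def)
    qed
    then show "set (cols (part U)) \<subseteq> span U"
      using U part_carrier[of U] by (auto simp: cols_def)
  qed (rule part_carrier)
  have A_eq: "A = part T + part (S - T)"
  proof (rule eq_matI)
    fix i j assume "i < dim_row (part T + part (S - T))" "j < dim_col (part T + part (S - T))"
    then have ij: "i < n" "j < nc"
      by (simp_all add: part_def)
    then have "A $$ (i, j) = col A j $ i"
      using A by simp
    also have "\<dots> = (\<Sum>x\<in>S. a j x * x $ i)"
      using ij a S by (simp add: lincomb_index)
    also have "\<dots> = (\<Sum>x\<in>T. a j x * x $ i) + (\<Sum>x\<in>S - T. a j x * x $ i)"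
      using S(1) T(1) by (simp add: sum.subset_diff add.commute)
    finally show "A $$ (i, j) = (part T + part (S - T)) $$ (i, j)"
      using ij by (simp add: part_def)
  qed (use A in \<open>auto simp: part_def\<close>)
  \<comment> \<open>The sign turns the sum into a difference. Writing the negation as a difference
    from the zero matrix lets \<open>rank_diff_le\<close> bound its rank.\<close>
  let ?C = "0\<^sub>m n nc - part (S - T)"
  have "A = part T - ?C"
    unfolding A_eq by (intro eq_matI) (auto simp: part_def)
  moreover have "rank ?C \<le> \<delta>"
    using rank_diff_le[of "0\<^sub>m n nc" nc "part (S - T)"] part_carrier rank_part[of "S - T"] T(3)
    by (simp add: rank_0I)
  moreover have "rank (part T) \<le> \<delta>"
    using rank_part[of T] T by simp
  moreover have "?C \<in> carrier_mat n nc"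
    by (intro minus_carrier_mat part_carrier)
  ultimately show
    "\<exists>B\<in>carrier_mat n nc. \<exists>C\<in>carrier_mat n nc. A = B - C \<and> rank B \<le> \<delta> \<and> rank C \<le> \<delta>"
    using part_carrier[of T] by blast
next
  assume "\<exists>B\<in>carrier_mat n nc. \<exists>C\<in>carrier_mat n nc. A = B - C \<and> rank B \<le> \<delta> \<and> rank C \<le> \<delta>"
  then obtain B C where BC: "B \<in> carrier_mat n nc" "C \<in> carrier_mat n nc"
    "A = B - C" "rank B \<le> \<delta>" "rank C \<le> \<delta>"
    by blast
  then show "rank A \<le> 2 * \<delta>"
    using rank_diff_le[OF BC(1,2)] by simp
qed

end

lemma rank_weight_le_double_iff:
  assumes "A \<in> carrier_mat N t"
  shows "rank_weight A \<le> 2 * \<delta> \<longleftrightarrow>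
    (\<exists>B\<in>carrier_mat N t. \<exists>C\<in>carrier_mat N t.
       A = B - C \<and> rank_weight B \<le> \<delta> \<and> rank_weight C \<le> \<delta>)"
  using vec_space.rank_le_double_iff[OF assms, of \<delta>] assms by (auto simp: rank_weight_def)

subsection \<open>Error-correcting index codes\<close>

text \<open>A decoder exists exactly when the received word and the side information determine the
  requested value. Neither linearity of \<open>E\<close> nor any property of \<open>w\<close>
  enters.\<close>

lemma is_ECIC_iff:
  assumes E: "E \<in> carrier_mat (len I) (blk I) \<rightarrow> carrier_mat N (blk I)"
    and M: "M \<subseteq> carrier_mat (len I) (blk I)"
    and R: "request I \<in> carrier_mat (users I) (len I)"
  shows "is_ECIC w I V M \<delta> N E \<longleftrightarrow>
    (\<forall>i<users I. \<forall>X\<in>M. \<forall>X'\<in>M. \<forall>W\<in>carrier_mat N (blk I). \<forall>W'\<in>carrier_mat N (blk I).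
       V i * X = V i * X' \<and> E X + W = E X' + W' \<and> w W \<le> \<delta> \<and> w W' \<le> \<delta> \<longrightarrow>
       row_mult (row (request I) i) X = row_mult (row (request I) i) X')"
    (is "_ \<longleftrightarrow> (\<forall>i<users I. ?decodable i)")
proof
  assume ecic: "is_ECIC w I V M \<delta> N E"
  show "\<forall>i<users I. ?decodable i"
  proof (intro allI impI)
    fix i assume "i < users I"
    with ecic obtain D where
      "\<forall>X\<in>M. \<forall>W\<in>carrier_mat N (blk I). w W \<le> \<delta> \<longrightarrow>
         D (E X + W) (V i * X) = row_mult (row (request I) i) X"
      unfolding is_ECIC_def by metis
    then have D: "D (E X + W) (V i * X) = row_mult (row (request I) i) X"
      if "X \<in> M" "W \<in> carrier_mat N (blk I)" "w W \<le> \<delta>" for X W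
      using that by simp
    show "?decodable i"
    proof (intro ballI impI, elim conjE)
      fix X X' W W'
      assume *: "X \<in> M" "X' \<in> M" "W \<in> carrier_mat N (blk I)" "W' \<in> carrier_mat N (blk I)"
        "V i * X = V i * X'" "E X + W = E X' + W'" "w W \<le> \<delta>" "w W' \<le> \<delta>"
      have "row_mult (row (request I) i) X = D (E X + W) (V i * X)"
        by (rule D[symmetric]) (fact *)+
      also have "\<dots> = row_mult (row (request I) i) X'"
        unfolding *(5,6) by (rule D) (fact *)+
      finally show "row_mult (row (request I) i) X = row_mult (row (request I) i) X'" .
    qed
  qed
next
  assume dec: "\<forall>i<users I. ?decodable i"
  have "\<exists>D. D \<in> carrier_mat N (blk I) \<rightarrow> carrier_mat (user_dim I i) (blk I) \<rightarrow> carrier_vec (blk I) \<and>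
        (\<forall>X\<in>M. \<forall>W\<in>carrier_mat N (blk I). w W \<le> \<delta> \<longrightarrow>
           D (E X + W) (V i * X) = row_mult (row (request I) i) X)"
    if i: "i < users I" for i
  proof -
    \<comment> \<open>\<open>P Y S X\<close> says that the message \<open>X\<close> is consistent
      with the received word \<open>Y\<close> and the side information \<open>S\<close>.\<close>
    define P where "P Y S X \<longleftrightarrow> X \<in> M \<and> V i * X = S \<and>
      (\<exists>W\<in>carrier_mat N (blk I). w W \<le> \<delta> \<and> E X + W = Y)" for Y S X
    \<comment> \<open>The decoder answers for an arbitrary consistent message. The zero vector is
      the default when there is none, so that \<open>D\<close> always has values of length
      \<open>blk I\<close>.\<close>
    define D where "D Y S = (if \<exists>X. P Y S X then row_mult (row (request I) i) (SOME X. P Y S X)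
      else 0\<^sub>v (blk I))" for Y S
    have "D Y S \<in> carrier_vec (blk I)" for Y S
    proof (cases "\<exists>X. P Y S X")
      case True
      then have "(SOME X. P Y S X) \<in> M"
        using someI_ex[of "P Y S"] P_def by blast
      then have "dim_col (SOME X. P Y S X) = blk I"
        using M by auto
      with True show ?thesis
        by (auto simp: D_def row_mult_def intro!: carrier_vecI)
    qed (simp add: D_def)
    moreover have "D (E X + W) (V i * X) = row_mult (row (request I) i) X"
      if "X \<in> M" "W \<in> carrier_mat N (blk I)" "w W \<le> \<delta>" for X W
    proof -
      let ?X = "SOME X'. P (E X + W) (V i * X) X'"
      \<comment> \<open>The message sent is itself consistent, so the choice succeeds; by
        \<open>dec\<close>, the chosen message has the same requested value.\<close>
      have "P (E X + W) (V i * X) X"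
        using that by (auto simp: P_def)
      then have ex: "\<exists>X'. P (E X + W) (V i * X) X'" ..
      then have "P (E X + W) (V i * X) ?X"
        by (rule someI_ex)
      then have "row_mult (row (request I) i) ?X = row_mult (row (request I) i) X"
        using dec i that unfolding P_def by blast
      with ex show ?thesis
        by (simp add: D_def)
    qed
    ultimately show ?thesis
      by (intro exI[of _ D]) auto
  qed
  with E show "is_ECIC w I V M \<delta> N E"
    unfolding is_ECIC_def by blast
qed

lemma minus_eq_zero_mat_iff:
  fixes A B :: "'a::group_add mat"
  assumes "A \<in> carrier_mat nr nc" and "B \<in> carrier_mat nr nc"
  shows "A - B = 0\<^sub>m nr nc \<longleftrightarrow> A = B"
  using assms by (auto simp: mat_eq_iff)

lemma minus_eq_zero_vec_iff:
  fixes u v :: "'a::group_add vec"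
  assumes "u \<in> carrier_vec k" and "v \<in> carrier_vec k"
  shows "u - v = 0\<^sub>v k \<longleftrightarrow> u = v"
  using assms by (auto simp: vec_eq_iff)

lemma row_mult_diff:
  fixes X X' :: "'a::comm_ring mat"
  assumes "v \<in> carrier_vec k" and "X \<in> carrier_mat k t" and "X' \<in> carrier_mat k t"
  shows "row_mult v (X - X') = row_mult v X - row_mult v X'"
proof -
  have "(X - X')\<^sup>T = X\<^sup>T - X'\<^sup>T"
    using assms by auto
  then show ?thesis
    using assms by (simp add: row_mult_def minus_mult_distrib_mat_vec[of _ t k])
qed

text \<open>By linearity, both conditions on the difference become conditions on the pair: equal
  side information, different requests.\<close>

lemma diff_in_confusion_set_iff:
  assumes "V i \<in> carrier_mat (user_dim I i) (len I)"
    and "row (request I) i \<in> carrier_vec (len I)"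
    and "X \<in> carrier_mat (len I) (blk I)" and "X' \<in> carrier_mat (len I) (blk I)"
  shows "X - X' \<in> confusion_set I V i \<longleftrightarrow>
    V i * X = V i * X' \<and> row_mult (row (request I) i) X \<noteq> row_mult (row (request I) i) X'"
proof -
  have "row_mult (row (request I) i) Y \<in> carrier_vec (blk I)"
    if "Y \<in> carrier_mat (len I) (blk I)" for Y
    using that by (auto simp: row_mult_def intro!: carrier_vecI)
  then show ?thesis
    using assms unfolding confusion_set_def
    by (simp add: row_mult_diff mult_minus_distrib_mat minus_carrier_mat
        minus_eq_zero_mat_iff[of _ "user_dim I i" "blk I"] minus_eq_zero_vec_iff)
qed

text \<open>Two code words can be received as the same word exactly when their difference is a
  difference of errors, with the errors in reversed order.\<close>

lemma mat_add_eq_add_iff_diff: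
  fixes A B C D :: "'a::ab_group_add mat"
  assumes "A \<in> carrier_mat nr nc" "B \<in> carrier_mat nr nc"
    and "C \<in> carrier_mat nr nc" "D \<in> carrier_mat nr nc"
  shows "A + C = B + D \<longleftrightarrow> A - B = D - C"
  using assms by (auto simp: mat_eq_iff algebra_simps)

theorem mainTheorem6:
  fixes I :: "'a::{finite,field} iccsi"
    and VS L :: "'a mat"
    and V :: "nat \<Rightarrow> 'a mat"
    and M :: "'a mat set"
    and \<delta> N :: nat
    and w :: "'a mat \<Rightarrow> nat"
  assumes "iccsi_instance I"
    and "generator_matrices I VS V"
    and "M \<subseteq> carrier_mat (len I) (blk I)"
    and "0 < N"
    and "w = hamming_weight \<or> (1 < blk I \<and> w = rank_weight)"
    and "L \<in> carrier_mat N (sender_dim I)"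
  shows "represents_linear_ECIC w I VS V M \<delta> N L \<longleftrightarrow>
    (\<forall>i<users I. \<forall>X\<in>M. \<forall>X'\<in>M. X - X' \<in> confusion_set I V i \<longrightarrow>
       2 * \<delta> + 1 \<le> w (L * VS * (X - X')))"
proof -
  let ?G = "L * VS" and ?Msg = "carrier_mat (len I) (blk I)"
  have R: "request I \<in> carrier_mat (users I) (len I)"
    using assms(1) by (simp add: iccsi_instance_def)
  have G: "?G \<in> carrier_mat N (len I)"
    using assms(2,6) by (auto simp: generator_matrices_def)
  have V: "V i \<in> carrier_mat (user_dim I i) (len I)" if "i < users I" for i
    using assms(2) that by (simp add: generator_matrices_def)
  \<comment> \<open>From here on the weight enters only through this property, which holds in both
    cases.\<close>
  have double: "w A \<le> 2 * \<delta> \<longleftrightarrow> (\<exists>B\<in>carrier_mat N (blk I). \<exists>C\<in>carrier_mat N (blk I).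
      A = B - C \<and> w B \<le> \<delta> \<and> w C \<le> \<delta>)" if "A \<in> carrier_mat N (blk I)" for A
    using assms(5) hamming_weight_le_double_iff[OF that] rank_weight_le_double_iff[OF that] by blast
  \<comment> \<open>The decomposition from \<open>double\<close> is applied with \<open>B\<close> as
    \<open>W'\<close> and \<open>C\<close> as \<open>W\<close>.\<close>
  have collide: "w (?G * (X - X')) \<le> 2 * \<delta> \<longleftrightarrow>
      (\<exists>W\<in>carrier_mat N (blk I). \<exists>W'\<in>carrier_mat N (blk I).
         ?G * X + W = ?G * X' + W' \<and> w W \<le> \<delta> \<and> w W' \<le> \<delta>)"
    if "X \<in> ?Msg" "X' \<in> ?Msg" for X X'
  proof -
    have "?G * X \<in> carrier_mat N (blk I)" "?G * X' \<in> carrier_mat N (blk I)"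
      using G that by (auto intro: mult_carrier_mat)
    moreover have "?G * (X - X') = ?G * X - ?G * X'"
      using G that by (rule mult_minus_distrib_mat)
    ultimately show ?thesis
      using double[of "?G * X - ?G * X'"] mat_add_eq_add_iff_diff[of "?G * X" N "blk I" "?G * X'"]
      by (auto simp: minus_carrier_mat)
  qed
  \<comment> \<open>Stated for every \<open>E\<close> that agrees with multiplication by
    \<open>?G\<close> on matrices of message size, since the representation leaves \<open>E\<close>
    free elsewhere.\<close>
  have ecic: "is_ECIC w I V M \<delta> N E \<longleftrightarrow>
      (\<forall>i<users I. \<forall>X\<in>M. \<forall>X'\<in>M. X - X' \<in> confusion_set I V i \<longrightarrow>
         2 * \<delta> + 1 \<le> w (?G * (X - X')))"
    if E: "\<And>X. X \<in> ?Msg \<Longrightarrow> E X = ?G * X" for E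
  proof -
    have "E \<in> ?Msg \<rightarrow> carrier_mat N (blk I)"
      using E G by (auto intro: mult_carrier_mat)
    note iff = is_ECIC_iff[OF this assms(3) R, of w V \<delta>]
    have weight_iff: "2 * \<delta> + 1 \<le> w (?G * (X - X')) \<longleftrightarrow>
      \<not> (\<exists>W\<in>carrier_mat N (blk I). \<exists>W'\<in>carrier_mat N (blk I).
         E X + W = E X' + W' \<and> w W \<le> \<delta> \<and> w W' \<le> \<delta>)"
      if "X \<in> M" "X' \<in> M" for X X'
    proof -
      have msg: "X \<in> ?Msg" "X' \<in> ?Msg"
        using that assms(3) by blast+
      show ?thesis
        unfolding E[OF msg(1)] E[OF msg(2)] collide[OF msg, symmetric] by linarith
    qed
    have confusion_iff: "X - X' \<in> confusion_set I V i \<longleftrightarrow> V i * X = V i * X' \<and>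
        row_mult (row (request I) i) X \<noteq> row_mult (row (request I) i) X'"
      if "i < users I" "X \<in> M" "X' \<in> M" for i X X'
    proof (rule diff_in_confusion_set_iff)
      show "row (request I) i \<in> carrier_vec (len I)"
        using R by (auto intro: carrier_vecI)
    qed (use that assms(3) V in blast)+
    show ?thesis
      \<comment> \<open>Pair by pair, both sides say that equal side information and different
        requests exclude a collision; only the order of the implications differs.\<close>
      unfolding iff
    proof (intro all_cong ball_cong refl)
      fix i X X' assume "i < users I" "X \<in> M" "X' \<in> M"
      then show "(\<forall>W\<in>carrier_mat N (blk I). \<forall>W'\<in>carrier_mat N (blk I).
          V i * X = V i * X' \<and> E X + W = E X' + W' \<and> w W \<le> \<delta> \<and> w W' \<le> \<delta> \<longrightarrow>
          row_mult (row (request I) i) X = row_mult (row (request I) i) X') \<longleftrightarrow>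
        (X - X' \<in> confusion_set I V i \<longrightarrow> 2 * \<delta> + 1 \<le> w (?G * (X - X')))"
        unfolding weight_iff[OF \<open>X \<in> M\<close> \<open>X' \<in> M\<close>]
          confusion_iff[OF \<open>i < users I\<close> \<open>X \<in> M\<close> \<open>X' \<in> M\<close>] by blast
    qed
  qed
  \<comment> \<open>The criterion in \<open>ecic\<close> does not mention \<open>E\<close>, so any
    representing map may be replaced by multiplication by \<open>?G\<close>.\<close>
  have "represents_linear_ECIC w I VS V M \<delta> N L \<longleftrightarrow> is_ECIC w I V M \<delta> N (\<lambda>X. ?G * X)"
  proof
    assume "represents_linear_ECIC w I VS V M \<delta> N L"
    then obtain E where "is_ECIC w I V M \<delta> N E" "\<And>X. X \<in> ?Msg \<Longrightarrow> E X = ?G * X"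
      unfolding represents_linear_ECIC_def by blast
    then show "is_ECIC w I V M \<delta> N (\<lambda>X. ?G * X)"
      by (simp add: ecic)
  next
    assume "is_ECIC w I V M \<delta> N (\<lambda>X. ?G * X)"
    with assms(6) show "represents_linear_ECIC w I VS V M \<delta> N L"
      unfolding represents_linear_ECIC_def by (auto intro!: exI[of _ "\<lambda>X. ?G * X"])
  qed
  also note ecic[of "\<lambda>X. ?G * X", OF refl]
  finally show ?thesis .
qed

end
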